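(* Let $(G,+)$ be a finite abelian group, $n$ a positive integer, $W=G\wr S_n$, $\underline\sigma\in\Sigma_n(G)$, let $H=H_{\underline\sigma}$ be the stabiliser of a $\underline\sigma$-tabloid and let $Y$ be a nonempty subset of $W$. (a) If $Y$ is a $\underline\sigma$-clique, then $|Y|\le|W|/|H|$, with equality if and only if $Y$ is $\underline\sigma$-transitive. (b) If $Y$ is $\underline\sigma$-transitive, then $|Y|\ge|W|/|H|$, with equality if and only if $Y$ is a $\underline\sigma$-clique. In both cases, equality implies that $Y$ is sharply $\underline\sigma$-transitive.
   Context: $[n]=\{1,\dots,n\}$. $W=G\wr S_n$ consists of pairs $(g,\pi)$, $g\in G^n$, $\pi\in S_n$, with $(f,\pi)(g,\sigma)=(f+g^\pi,\pi\sigma)$, $g^\pi=(g_{\pi^{-1}(1)},\dots,g_{\pi^{-1}(n)})$. $\Sigma_n(G)$ is the set of maps $\underline\sigma$ from the set of subgroups of $G$ to partitions with $\sum_{U\le G}|\underline\sigma(U)|=n$. Tabloids: a $\underline\sigma$-tableau consists of, for each $U\le G$, the Young diagram of $\underline\sigma(U)$ with boxes filled by pairs $(c,i)$, $c\in G/U$, $i\in[n]$, all $i$ pairwise distinct; row-equivalence classes are $\underline\sigma$-tabloids; $W$ acts entrywise by $(g,\pi)\cdot(c,i)=(c+g_{\pi(i)},\pi(i))$. A nonempty $Y\subseteq W$ is $\underline\sigma$-transitive if there is $c>0$ such that for any two $\underline\sigma$-tabloids $a,b$ exactly $c$ elements $y\in Y$ satisfy $ya=b$; sharply if $c=1$. $Y$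 is a $\underline\sigma$-clique if for all distinct $x,y\in Y$ no $\underline\sigma$-tabloid is fixed by $x^{-1}y$. *)

theory Defs
  imports Complex_Main "HOL-Algebra.Group_Action" "HOL-Combinatorics.Permutations"
begin

text \<open>
  The finite abelian group \<open>(G, +)\<close> is a multiplicatively written \<^locale>\<open>comm_group\<close>.  In \<^term>\<open>wreath G n\<close> the function \<open>\<lambda>i. g (\<pi>\<^sup>-\<^sup>1 i)\<close> is the
  tuple \<open>g\<^sup>\<pi>\<close>.
\<close>

definition wreath ::
  "('a, 'b) monoid_scheme \<Rightarrow> nat \<Rightarrow> ((nat \<Rightarrow> 'a) \<times> (nat \<Rightarrow> nat)) monoid" where
  "wreath G n =
    \<lparr> carrier = ({1..n} \<rightarrow>\<^sub>E carrier G) \<times> {\<pi>. \<pi> permutes {1..n}},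
      monoid.mult = (\<lambda>(f, \<pi>) (g, \<sigma>).
        (\<lambda>i\<in>{1..n}. f i \<otimes>\<^bsub>G\<^esub> g (inv_into UNIV \<pi> i), \<pi> \<circ> \<sigma>)),
      monoid.one = (\<lambda>i\<in>{1..n}. \<one>\<^bsub>G\<^esub>, id) \<rparr>"

definition partitions :: "nat list set" where
  "partitions = {ps. sorted_wrt (\<ge>) ps \<and> 0 \<notin> set ps}"

definition Sigma_maps :: "('a, 'b) monoid_scheme \<Rightarrow> nat \<Rightarrow> ('a set \<Rightarrow> nat list) set" where
  "Sigma_maps G n =
    {\<sigma> \<in> {U. subgroup U G} \<rightarrow>\<^sub>E partitions. (\<Sum>U | subgroup U G. sum_list (\<sigma> U)) = n}"

text \<open>Rows and columns of a Young diagram are numbered from 0.\<close>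

definition young_diagram :: "nat list \<Rightarrow> (nat \<times> nat) set" where
  "young_diagram ps = {(r, c). r < length ps \<and> c < ps ! r}"

text \<open>The box in row \<open>r\<close> and column \<open>c\<close> of the diagram belonging to \<open>U\<close> is \<open>(U, r, c)\<close>.\<close>

definition boxes ::
  "('a, 'b) monoid_scheme \<Rightarrow> ('a set \<Rightarrow> nat list) \<Rightarrow> ('a set \<times> nat \<times> nat) set" where
  "boxes G \<sigma> = (SIGMA U:{U. subgroup U G}. young_diagram (\<sigma> U))"

type_synonym 'a tableau = "'a set \<times> nat \<times> nat \<Rightarrow> 'a set \<times> nat"

definition tableaux ::
  "('a, 'b) monoid_scheme \<Rightarrow> nat \<Rightarrow> ('a set \<Rightarrow> nat list) \<Rightarrow> 'a tableau set" where
  "tableaux G n \<sigma> =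
    {T \<in> (\<Pi>\<^sub>E (U, r, c)\<in>boxes G \<sigma>. carrier (G Mod U) \<times> {1..n}).
      inj_on (\<lambda>b. snd (T b)) (boxes G \<sigma>)}"

definition row_equivalence ::
  "('a, 'b) monoid_scheme \<Rightarrow> nat \<Rightarrow> ('a set \<Rightarrow> nat list) \<Rightarrow> ('a tableau \<times> 'a tableau) set" where
  "row_equivalence G n \<sigma> =
    {(S, T). S \<in> tableaux G n \<sigma> \<and> T \<in> tableaux G n \<sigma> \<and>
      (\<exists>p. p permutes boxes G \<sigma> \<and>
        (\<forall>(U, r, c)\<in>boxes G \<sigma>. \<exists>c'. p (U, r, c) = (U, r, c')) \<and>
        T = S \<circ> p)}"

definition tabloids ::
  "('a, 'b) monoid_scheme \<Rightarrow> nat \<Rightarrow> ('a set \<Rightarrow> nat list) \<Rightarrow> 'a tableau set set" where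
  "tabloids G n \<sigma> = tableaux G n \<sigma> // row_equivalence G n \<sigma>"

definition act_entry ::
  "('a, 'b) monoid_scheme \<Rightarrow> (nat \<Rightarrow> 'a) \<times> (nat \<Rightarrow> nat) \<Rightarrow> 'a set \<times> nat \<Rightarrow> 'a set \<times> nat" where
  "act_entry G = (\<lambda>(g, \<pi>) (C, i). (C #>\<^bsub>G\<^esub> g (\<pi> i), \<pi> i))"

definition act_tableau ::
  "('a, 'b) monoid_scheme \<Rightarrow> ('a set \<Rightarrow> nat list) \<Rightarrow>
    (nat \<Rightarrow> 'a) \<times> (nat \<Rightarrow> nat) \<Rightarrow> 'a tableau \<Rightarrow> 'a tableau" where
  "act_tableau G \<sigma> w T = (\<lambda>b\<in>boxes G \<sigma>. act_entry G w (T b))"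

definition act_tabloid ::
  "('a, 'b) monoid_scheme \<Rightarrow> ('a set \<Rightarrow> nat list) \<Rightarrow>
    (nat \<Rightarrow> 'a) \<times> (nat \<Rightarrow> nat) \<Rightarrow> 'a tableau set \<Rightarrow> 'a tableau set" where
  "act_tabloid G \<sigma> w a = act_tableau G \<sigma> w ` a"

text \<open>
  The following three notions are meant for nonempty subsets \<open>Y\<close> of \<^term>\<open>carrier (wreath G n)\<close>.
\<close>

definition transitive_with ::
  "('a, 'b) monoid_scheme \<Rightarrow> nat \<Rightarrow> ('a set \<Rightarrow> nat list) \<Rightarrow> nat \<Rightarrow>
    ((nat \<Rightarrow> 'a) \<times> (nat \<Rightarrow> nat)) set \<Rightarrow> bool" where
  "transitive_with G n \<sigma> c Y \<longleftrightarrow>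
    (\<forall>a\<in>tabloids G n \<sigma>. \<forall>b\<in>tabloids G n \<sigma>. card {y \<in> Y. act_tabloid G \<sigma> y a = b} = c)"

definition transitive ::
  "('a, 'b) monoid_scheme \<Rightarrow> nat \<Rightarrow> ('a set \<Rightarrow> nat list) \<Rightarrow>
    ((nat \<Rightarrow> 'a) \<times> (nat \<Rightarrow> nat)) set \<Rightarrow> bool" where
  "transitive G n \<sigma> Y \<longleftrightarrow> (\<exists>c>0. transitive_with G n \<sigma> c Y)"

definition sharply_transitive ::
  "('a, 'b) monoid_scheme \<Rightarrow> nat \<Rightarrow> ('a set \<Rightarrow> nat list) \<Rightarrow>
    ((nat \<Rightarrow> 'a) \<times> (nat \<Rightarrow> nat)) set \<Rightarrow> bool" where
  "sharply_transitive G n \<sigma> Y \<longleftrightarrow> transitive_with G n \<sigma> 1 Y"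

definition clique ::
  "('a, 'b) monoid_scheme \<Rightarrow> nat \<Rightarrow> ('a set \<Rightarrow> nat list) \<Rightarrow>
    ((nat \<Rightarrow> 'a) \<times> (nat \<Rightarrow> nat)) set \<Rightarrow> bool" where
  "clique G n \<sigma> Y \<longleftrightarrow>
    (\<forall>x\<in>Y. \<forall>y\<in>Y. x \<noteq> y \<longrightarrow>
      \<not> (\<exists>a\<in>tabloids G n \<sigma>.
          act_tabloid G \<sigma> (inv\<^bsub>wreath G n\<^esub> x \<otimes>\<^bsub>wreath G n\<^esub> y) a = a))"

end

theory Submission
  imports Defs
begin

text \<open>
  The group \<open>W\<close> acts transitively on the tabloids, so by orbit-stabiliser there are \<open>|W|/|H|\<close> of
  them.  A subset \<open>Y\<close> is a clique iff every evaluation map \<open>y \<mapsto> ya\<close> from \<open>Y\<close> to the tabloids is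
  injective, and transitive iff all fibres of all these maps have the same positive size \<open>c\<close>, in which
  case \<open>|Y| = c|W|/|H|\<close>.  In both cases equality means that every evaluation map is bijective.
\<close>

section \<open>Finite transitive group actions\<close>

text \<open>Since \<open>BijGroup E\<close> contains only bijections that are
  \<open>undefined\<close> outside \<open>E\<close>, the maps have to be restricted before they form
  a homomorphism into it. The axioms used here are the usual laws of an action, which are easier to
  verify for \<open>act_tabloid\<close>.\<close>

lemma group_actionI:
  assumes "group W"
    and closed: "\<And>w x. w \<in> carrier W \<Longrightarrow> x \<in> E \<Longrightarrow> \<phi> w x \<in> E"
    and one: "\<And>x. x \<in> E \<Longrightarrow> \<phi> \<one>\<^bsub>W\<^esub> x = x"
    and mult: "\<And>v w x. v \<in> carrier W \<Longrightarrow> w \<in> carrier W \<Longrightarrow> x \<in> E \<Longrightarrow>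
      \<phi> (v \<otimes>\<^bsub>W\<^esub> w) x = \<phi> v (\<phi> w x)"
  shows "group_action W E (\<lambda>w. restrict (\<phi> w) E)"
proof -
  interpret W: group W by fact
  \<comment> \<open>The action of the inverse of \<open>w\<close> is a two-sided inverse map on
    \<open>E\<close>; this yields bijectivity.\<close>
  have inv: "\<phi> (inv\<^bsub>W\<^esub> w) (\<phi> w x) = x" "\<phi> w (\<phi> (inv\<^bsub>W\<^esub> w) x) = x"
    if "w \<in> carrier W" "x \<in> E" for w x
    using that mult[of "inv\<^bsub>W\<^esub> w" w x] mult[of w "inv\<^bsub>W\<^esub> w" x] one by simp_all
  have bij: "restrict (\<phi> w) E \<in> Bij E" if "w \<in> carrier W" for w
  proof -
    have "bij_betw (\<phi> w) E E"
      by (rule bij_betw_byWitness[where f' = "\<phi> (inv\<^bsub>W\<^esub> w)"]) (use that inv closed in auto)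
    then show ?thesis
      by (simp add: Bij_def cong: bij_betw_cong)
  qed
  have "restrict (\<phi> (v \<otimes>\<^bsub>W\<^esub> w)) E = compose E (restrict (\<phi> v) E) (restrict (\<phi> w) E)"
    if "v \<in> carrier W" "w \<in> carrier W" for v w
    using that closed mult by (auto simp: compose_def fun_eq_iff)
  then have "(\<lambda>w. restrict (\<phi> w) E) \<in> hom W (BijGroup E)"
    using bij by (auto simp: hom_def BijGroup_def)
  then show ?thesis
    by (simp add: group_action_def group_hom_def group_hom_axioms_def assms(1) group_BijGroup)
qed

text \<open>The fibres of \<open>f\<close> partition \<open>Y\<close>. Applied to an evaluation map
  of a transitive set, this gives the size of that set.\<close>

lemma card_eq_mult_of_const_fibres:
  assumes "finite Y" "finite E" "\<And>y. y \<in> Y \<Longrightarrow> f y \<in> E"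
    and "\<And>b. b \<in> E \<Longrightarrow> card {y \<in> Y. f y = b} = c"
  shows "card Y = c * card E"
  using sum_fun_comp[of Y E f "\<lambda>_. 1 :: nat"] assms by (simp add: image_subset_iff)

text \<open>This puts the clique condition into the language of fibre sizes, in which transitivity
  is defined.\<close>

lemma inj_on_iff_card_fibres_le_1:
  assumes "finite Y" and "\<And>y. y \<in> Y \<Longrightarrow> f y \<in> E"
  shows "inj_on f Y \<longleftrightarrow> (\<forall>b\<in>E. card {y \<in> Y. f y = b} \<le> 1)"
proof
  assume "inj_on f Y"
  then show "\<forall>b\<in>E. card {y \<in> Y. f y = b} \<le> 1"
    by (auto simp: card_le_Suc0_iff_eq assms(1) inj_on_def)
next
  assume *: "\<forall>b\<in>E. card {y \<in> Y. f y = b} \<le> 1"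
  show "inj_on f Y"
  proof (rule inj_onI)
    fix x y
    assume "x \<in> Y" "y \<in> Y" "f x = f y"
    with * assms show "x = y"
      by (auto simp: card_le_Suc0_iff_eq)
  qed
qed

lemma bij_betw_imp_card_fibre:
  assumes "bij_betw f Y E" "b \<in> E"
  shows "card {y \<in> Y. f y = b} = 1"
proof -
  obtain x where "x \<in> Y" "f x = b"
    using assms by (auto simp: bij_betw_def)
  then have "{y \<in> Y. f y = b} = {x}"
    using assms(1) by (auto simp: bij_betw_def inj_on_def)
  then show ?thesis by simp
qed

section \<open>The wreath product\<close>

lemma wreath_simps:
  "x \<in> carrier (wreath G n) \<longleftrightarrow> fst x \<in> {1..n} \<rightarrow>\<^sub>E carrier G \<and> snd x permutes {1..n}"
  "x \<otimes>\<^bsub>wreath G n\<^esub> y =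
    (\<lambda>i\<in>{1..n}. fst x i \<otimes>\<^bsub>G\<^esub> fst y (inv_into UNIV (snd x) i), snd x \<circ> snd y)"
  "\<one>\<^bsub>wreath G n\<^esub> = (\<lambda>i\<in>{1..n}. \<one>\<^bsub>G\<^esub>, id)"
  by (auto simp: wreath_def mem_Times_iff case_prod_unfold)

lemma (in group) group_wreath: "group (wreath G n)"
proof (rule groupI)
  fix x y
  assume x: "x \<in> carrier (wreath G n)" and y: "y \<in> carrier (wreath G n)"
  then have px: "snd x permutes {1..n}" and py: "snd y permutes {1..n}"
    and fx: "\<And>i. i \<in> {1..n} \<Longrightarrow> fst x i \<in> carrier G"
    and fy: "\<And>i. i \<in> {1..n} \<Longrightarrow> fst y i \<in> carrier G"
    by (auto simp: wreath_simps PiE_iff)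
  have ix: "inv_into UNIV (snd x) i \<in> {1..n}" if "i \<in> {1..n}" for i
    using permutes_in_image[OF permutes_inv[OF px]] that by blast
  show "x \<otimes>\<^bsub>wreath G n\<^esub> y \<in> carrier (wreath G n)"
    using px py fx fy ix by (auto simp: wreath_simps intro!: permutes_compose)
  fix z
  assume z: "z \<in> carrier (wreath G n)"
  then have fz: "\<And>i. i \<in> {1..n} \<Longrightarrow> fst z i \<in> carrier G"
    by (auto simp: wreath_simps PiE_iff)
  have iy: "inv_into UNIV (snd y) i \<in> {1..n}" if "i \<in> {1..n}" for i
    using permutes_in_image[OF permutes_inv[OF py]] that by blast
  \<comment> \<open>Inversion reverses the composition, so shifting a tuple by \<open>snd y\<close>
    and then by \<open>snd x\<close> is shifting it by their composite. Associativity comes down to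
    this.\<close>
  have inv_comp: "inv_into UNIV (snd x \<circ> snd y) = inv_into UNIV (snd y) \<circ> inv_into UNIV (snd x)"
    using px py by (simp add: o_inv_distrib permutes_bij)
  show "x \<otimes>\<^bsub>wreath G n\<^esub> y \<otimes>\<^bsub>wreath G n\<^esub> z =
      x \<otimes>\<^bsub>wreath G n\<^esub> (y \<otimes>\<^bsub>wreath G n\<^esub> z)"
    unfolding wreath_simps prod.inject fst_conv snd_conv inv_comp
    using fx fy[OF ix] fz[OF iy[OF ix]] ix
    by (auto simp: fun_eq_iff m_assoc restrict_def simp del: atLeastAtMost_iff)
next
  show "\<one>\<^bsub>wreath G n\<^esub> \<in> carrier (wreath G n)"
    by (auto simp: wreath_simps permutes_id)
next
  fix x
  assume x: "x \<in> carrier (wreath G n)"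
  then show "\<one>\<^bsub>wreath G n\<^esub> \<otimes>\<^bsub>wreath G n\<^esub> x = x"
    by (cases x) (auto simp: wreath_simps PiE_iff extensional_def fun_eq_iff)
  from x have px: "snd x permutes {1..n}" and fx: "\<And>i. i \<in> {1..n} \<Longrightarrow> fst x i \<in> carrier G"
    by (auto simp: wreath_simps PiE_iff)
  \<comment> \<open>In the product with \<open>x\<close> on the right, the tuple of \<open>x\<close>
    is read at the inverse of the inverse of \<open>snd x\<close>, that is at
    \<open>snd x i\<close>. The i-th coordinate of the left inverse must cancel that entry.\<close>
  let ?y = "(\<lambda>i\<in>{1..n}. inv (fst x (snd x i)), inv_into UNIV (snd x))"
  have "?y \<in> carrier (wreath G n)"
    using fx permutes_in_image[OF px]
    by (auto simp: wreath_simps permutes_inv[OF px] simp del: atLeastAtMost_iff One_nat_def)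
  moreover have "?y \<otimes>\<^bsub>wreath G n\<^esub> x = \<one>\<^bsub>wreath G n\<^esub>"
    using fx permutes_in_image[OF px]
    by (auto simp: wreath_simps permutes_inv_o[OF px] permutes_inv_inv[OF px] fun_eq_iff restrict_def
        simp del: atLeastAtMost_iff One_nat_def)
  ultimately show "\<exists>y\<in>carrier (wreath G n). y \<otimes>\<^bsub>wreath G n\<^esub> x = \<one>\<^bsub>wreath G n\<^esub>"
    by blast
qed

lemma finite_wreath:
  assumes "finite (carrier G)"
  shows "finite (carrier (wreath G n))"
  using assms by (auto simp: wreath_def intro!: finite_PiE finite_permutations)

section \<open>The action on tableaux and tabloids\<close>

lemma tableauD:
  assumes "T \<in> tableaux G n \<sigma>" "b \<in> boxes G \<sigma>"
  shows "subgroup (fst b) G" "fst (T b) \<in> rcosets\<^bsub>G\<^esub> (fst b)" "snd (T b) \<in> {1..n}"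
  using assms by (fastforce simp: tableaux_def boxes_def PiE_iff FactGroup_def)+

lemma tableau_outside:
  assumes "T \<in> tableaux G n \<sigma>" "b \<notin> boxes G \<sigma>"
  shows "T b = undefined"
  using assms unfolding tableaux_def by (blast intro: PiE_arb)

lemma tableauI:
  assumes "T \<in> extensional (boxes G \<sigma>)"
    and "\<And>b. b \<in> boxes G \<sigma> \<Longrightarrow> fst (T b) \<in> rcosets\<^bsub>G\<^esub> (fst b) \<and> snd (T b) \<in> {1..n}"
    and "inj_on (\<lambda>b. snd (T b)) (boxes G \<sigma>)"
  shows "T \<in> tableaux G n \<sigma>"
  using assms by (fastforce simp: tableaux_def PiE_iff FactGroup_def mem_Times_iff)

context comm_group
begin

lemma act_entry_simps:
  "fst (act_entry G w e) = fst e #> fst w (snd w (snd e))"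
  "snd (act_entry G w e) = snd w (snd e)"
  by (auto simp: act_entry_def split: prod.splits)

lemma act_tableau_closed:
  assumes w: "w \<in> carrier (wreath G n)" and T: "T \<in> tableaux G n \<sigma>"
  shows "act_tableau G \<sigma> w T \<in> tableaux G n \<sigma>"
proof (rule tableauI)
  have p: "snd w permutes {1..n}" and f: "\<And>i. i \<in> {1..n} \<Longrightarrow> fst w i \<in> carrier G"
    using w by (auto simp: wreath_simps PiE_iff)
  show "act_tableau G \<sigma> w T \<in> extensional (boxes G \<sigma>)"
    by (simp add: act_tableau_def)
  show "inj_on (\<lambda>b. snd (act_tableau G \<sigma> w T b)) (boxes G \<sigma>)"
    using T permutes_inj[OF p]
    by (auto simp: act_tableau_def act_entry_simps tableaux_def inj_on_def inj_def)
  fix b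
  assume b: "b \<in> boxes G \<sigma>"
  note Tb = tableauD[OF T b]
  then obtain a where a: "a \<in> carrier G" "fst (T b) = fst b #> a"
    by (auto simp: RCOSETS_def)
  have i: "snd w (snd (T b)) \<in> {1..n}"
    using permutes_in_image[OF p] Tb(3) by blast
  \<comment> \<open>A right translate of a coset of \<open>U\<close> is a coset of the same
    \<open>U\<close>. The new label was placed in \<open>{1..n}\<close> first because only there
    does the tuple take values in the group.\<close>
  with a Tb(1) f have "fst (T b) #> fst w (snd w (snd (T b))) \<in> rcosets (fst b)"
    by (simp add: coset_mult_assoc subgroup.subset rcosetsI del: atLeastAtMost_iff)
  with i show "fst (act_tableau G \<sigma> w T b) \<in> rcosets (fst b) \<and>
      snd (act_tableau G \<sigma> w T b) \<in> {1..n}"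
    using b by (simp add: act_tableau_def act_entry_simps)
qed

lemma tableau_entry_subset:
  assumes "T \<in> tableaux G n \<sigma>" "b \<in> boxes G \<sigma>"
  shows "fst (T b) \<subseteq> carrier G"
  using tableauD(1,2)[OF assms] rcosets_subset_PowG by blast

lemma act_tableau_one:
  assumes T: "T \<in> tableaux G n \<sigma>"
  shows "act_tableau G \<sigma> \<one>\<^bsub>wreath G n\<^esub> T = T"
proof
  fix b
  show "act_tableau G \<sigma> \<one>\<^bsub>wreath G n\<^esub> T b = T b"
  proof (cases "b \<in> boxes G \<sigma>")
    case True
    then show ?thesis
      using tableauD(3)[OF T True] tableau_entry_subset[OF T True]
      by (simp add: act_tableau_def act_entry_simps prod_eq_iff wreath_simps coset_mult_one)
  next
    case False
    then show ?thesis
      using tableau_outside[OF T] by (simp add: act_tableau_def)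
  qed
qed

text \<open>Commutativity of \<open>G\<close> enters here: translating first by the coordinate of
  \<open>w\<close> and then by that of \<open>v\<close> multiplies them in the opposite order to the
  wreath product. The coordinates themselves match because the shift by the inverse of
  \<open>snd v\<close> turns the label \<open>snd v ?j\<close> back into \<open>?j\<close>.\<close>

lemma act_tableau_mult:
  assumes v: "v \<in> carrier (wreath G n)" and w: "w \<in> carrier (wreath G n)"
    and T: "T \<in> tableaux G n \<sigma>"
  shows "act_tableau G \<sigma> (v \<otimes>\<^bsub>wreath G n\<^esub> w) T = act_tableau G \<sigma> v (act_tableau G \<sigma> w T)"
proof -
  have pv: "snd v permutes {1..n}" and fv: "\<And>i. i \<in> {1..n} \<Longrightarrow> fst v i \<in> carrier G"
    and pw: "snd w permutes {1..n}" and fw: "\<And>i. i \<in> {1..n} \<Longrightarrow> fst w i \<in> carrier G"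
    using v w by (auto simp: wreath_simps PiE_iff)
  have "act_entry G (v \<otimes>\<^bsub>wreath G n\<^esub> w) (T b) = act_entry G v (act_entry G w (T b))"
    if b: "b \<in> boxes G \<sigma>" for b
  proof -
    let ?j = "snd w (snd (T b))"
    have j: "?j \<in> {1..n}" "snd v ?j \<in> {1..n}"
      using tableauD(3)[OF T b] permutes_in_image[OF pw] permutes_in_image[OF pv] by blast+
    then show ?thesis
      using tableau_entry_subset[OF T b] fv fw
      by (simp add: prod_eq_iff act_entry_simps wreath_simps coset_mult_assoc m_comm
          permutes_inverses(2)[OF pv] del: atLeastAtMost_iff)
  qed
  then show ?thesis
    by (auto simp: act_tableau_def fun_eq_iff)
qed

text \<open>There are exactly \<open>n\<close> boxes, so each number in \<open>{1..n}\<close> labels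
  exactly one box of each tableau. Hence the permutation is forced on the labels, and each
  coordinate of the tuple can be chosen separately to carry one coset of a subgroup to
  another.\<close>

lemma act_tableau_transitive:
  assumes fin: "finite (carrier G)" and \<sigma>: "\<sigma> \<in> Sigma_maps G n"
    and S: "S \<in> tableaux G n \<sigma>" and T: "T \<in> tableaux G n \<sigma>"
  obtains w where "w \<in> carrier (wreath G n)" "act_tableau G \<sigma> w S = T"
proof -
  let ?B = "boxes G \<sigma>"
  have "finite {U. subgroup U G}"
    by (rule finite_subset[of _ "Pow (carrier G)"]) (use fin subgroup.subset in auto)
  moreover have young: "young_diagram ps = (SIGMA r:{..<length ps}. {..<ps ! r})" for ps
    by (auto simp: young_diagram_def)
  \<comment> \<open>Split into rows, a Young diagram has as many boxes as the sum of its parts, and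
    these sums add up to \<open>n\<close> over the finitely many subgroups.\<close>
  ultimately have "finite ?B" "card ?B = n"
    using \<sigma> by (auto simp: boxes_def Sigma_maps_def young sum_list_sum_nth atLeast0LessThan)
  have bij: "bij_betw (\<lambda>b. snd (X b)) ?B {1..n}" if "X \<in> tableaux G n \<sigma>" for X
  proof -
    have inj: "inj_on (\<lambda>b. snd (X b)) ?B"
      using that by (simp add: tableaux_def)
    have "(\<lambda>b. snd (X b)) ` ?B = {1..n}"
      by (rule card_subset_eq)
        (use tableauD(3)[OF that] \<open>card ?B = n\<close> in \<open>auto simp: card_image[OF inj]\<close>)
    with inj show ?thesis
      by (simp add: bij_betw_def)
  qed
  define box where "box X = inv_into ?B (\<lambda>b. snd (X b))" for X :: "'a tableau"
  have box: "box X i \<in> ?B" "snd (X (box X i)) = i" if "X \<in> tableaux G n \<sigma>" "i \<in> {1..n}" for X i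
    using bij_betw_imp_surj_on[OF bij[OF that(1)]] that(2)
    unfolding box_def by (simp_all add: inv_into_into f_inv_into_f[of i "\<lambda>b. snd (X b)"])
  have box_entry: "box X (snd (X b)) = b" if "X \<in> tableaux G n \<sigma>" "b \<in> ?B" for X b
    unfolding box_def using inv_into_f_f[OF bij_betw_imp_inj_on[OF bij[OF that(1)]] that(2)] .
  \<comment> \<open>The label of a box in \<open>S\<close> goes to the label of the same box in
    \<open>T\<close>. Outside \<open>{1..n}\<close> the map is the identity, as
    \<open>permutes\<close> demands.\<close>
  define \<pi> where "\<pi> i = (if i \<in> {1..n} then snd (T (box S i)) else i)" for i
  have "bij_betw (\<lambda>i. snd (T (box S i))) {1..n} {1..n}"
    using bij_betw_trans[OF bij_betw_inv_into[OF bij[OF S]] bij[OF T]]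
    by (simp add: box_def comp_def)
  then have "bij_betw \<pi> {1..n} {1..n}"
    by (subst bij_betw_cong[of _ _ "\<lambda>i. snd (T (box S i))"]) (simp_all add: \<pi>_def)
  then have \<pi>: "\<pi> permutes {1..n}"
    by (rule bij_imp_permutes) (simp only: \<pi>_def if_False)
  have "\<exists>g\<in>carrier G. fst (S b) #> g = fst (T b)" if b: "b \<in> ?B" for b
  proof -
    note sub = tableauD(1)[OF S b]
    obtain x y where x: "x \<in> carrier G" "fst (S b) = fst b #> x"
      and y: "y \<in> carrier G" "fst (T b) = fst b #> y"
      using tableauD(2)[OF S b] tableauD(2)[OF T b] by (auto simp: RCOSETS_def)
    \<comment> \<open>The coset of \<open>x\<close> is carried to the coset of \<open>y\<close> by
      right translation with \<open>inv x \<otimes> y\<close>.\<close>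
    then have "fst (S b) #> (inv x \<otimes> y) = fst (T b)"
      using sub by (simp add: coset_mult_assoc subgroup.subset inv_solve_left' flip: m_assoc)
    with x y show ?thesis by blast
  qed
  then obtain g where g: "\<And>b. b \<in> ?B \<Longrightarrow> g b \<in> carrier G \<and> fst (S b) #> g b = fst (T b)"
    by metis
  \<comment> \<open>\<open>act_entry\<close> reads the tuple at the new label
    \<open>\<pi> i\<close>, which is a label of \<open>T\<close>; therefore the box is looked up in
    \<open>T\<close> and not in \<open>S\<close>.\<close>
  let ?w = "(\<lambda>i\<in>{1..n}. g (box T i), \<pi>)"
  have "?w \<in> carrier (wreath G n)"
    using g box(1)[OF T] \<pi> by (auto simp: wreath_simps simp del: atLeastAtMost_iff)
  moreover have "act_entry G ?w (S b) = T b" if b: "b \<in> ?B" for b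
    using g[OF b] tableauD(3)[OF S b] tableauD(3)[OF T b] box_entry[OF S b] box_entry[OF T b]
    by (intro prod_eqI) (simp_all add: act_entry_simps \<pi>_def del: atLeastAtMost_iff)
  then have "act_tableau G \<sigma> ?w S = T"
    using tableau_outside[OF T] by (simp add: act_tableau_def fun_eq_iff restrict_def)
  ultimately show thesis
    by (rule that)
qed

section \<open>Passage from tableaux to tabloids\<close>

lemma row_equivalence_act_tableau:
  assumes w: "w \<in> carrier (wreath G n)" and ST: "(S, T) \<in> row_equivalence G n \<sigma>"
  shows "(act_tableau G \<sigma> w S, act_tableau G \<sigma> w T) \<in> row_equivalence G n \<sigma>"
proof -
  obtain p where p: "p permutes boxes G \<sigma>"
      "\<forall>(U, r, c)\<in>boxes G \<sigma>. \<exists>c'. p (U, r, c) = (U, r, c')" "T = S \<circ> p"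
    and "S \<in> tableaux G n \<sigma>" "T \<in> tableaux G n \<sigma>"
    using ST by (auto simp: row_equivalence_def)
  \<comment> \<open>The action changes entries while \<open>p\<close> moves boxes, so the two
    commute. Both sides are \<open>undefined\<close> off the boxes, since \<open>p\<close> fixes
    everything there.\<close>
  moreover have "act_tableau G \<sigma> w T = act_tableau G \<sigma> w S \<circ> p"
    using permutes_in_image[OF p(1)]
    by (auto simp: p(3) act_tableau_def fun_eq_iff restrict_def)
  ultimately show ?thesis
    using act_tableau_closed[OF w] p(1,2) by (force simp: row_equivalence_def)
qed

text \<open>Compatibility with row equivalence puts the image of a class inside a class. Equality
  follows by pulling a tableau of the target class back along the inverse of
  \<open>w\<close>.\<close>

lemma act_tabloid_class:
  assumes w: "w \<in> carrier (wreath G n)" and S: "S \<in> tableaux G n \<sigma>"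
  shows "act_tabloid G \<sigma> w (row_equivalence G n \<sigma> `` {S}) =
    row_equivalence G n \<sigma> `` {act_tableau G \<sigma> w S}"
proof -
  interpret W: group "wreath G n" by (rule group_wreath)
  note w' = W.inv_closed[OF w]
  have "T \<in> act_tabloid G \<sigma> w (row_equivalence G n \<sigma> `` {S})"
    if wST: "(act_tableau G \<sigma> w S, T) \<in> row_equivalence G n \<sigma>" for T
  proof -
    have T: "T \<in> tableaux G n \<sigma>"
      using wST by (simp add: row_equivalence_def)
    have "act_tableau G \<sigma> (inv\<^bsub>wreath G n\<^esub> w) (act_tableau G \<sigma> w S) = S"
      using act_tableau_mult[OF w' w S] act_tableau_one[OF S] w by simp
    then have "(S, act_tableau G \<sigma> (inv\<^bsub>wreath G n\<^esub> w) T) \<in> row_equivalence G n \<sigma>"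
      using row_equivalence_act_tableau[OF w' wST] by simp
    moreover have "act_tableau G \<sigma> w (act_tableau G \<sigma> (inv\<^bsub>wreath G n\<^esub> w) T) = T"
      using act_tableau_mult[OF w w' T] act_tableau_one[OF T] w by simp
    ultimately show ?thesis
      unfolding act_tabloid_def by (metis Image_singleton_iff image_eqI)
  qed
  then show ?thesis
    using row_equivalence_act_tableau[OF w] by (auto simp: act_tabloid_def)
qed

lemma act_tabloid_closed:
  assumes "w \<in> carrier (wreath G n)" "a \<in> tabloids G n \<sigma>"
  shows "act_tabloid G \<sigma> w a \<in> tabloids G n \<sigma>"
  using assms(2) unfolding tabloids_def
  by (elim quotientE)
    (auto simp: act_tabloid_class[OF assms(1)] intro!: quotientI act_tableau_closed[OF assms(1)])

lemma tabloid_subset: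
  assumes "a \<in> tabloids G n \<sigma>"
  shows "a \<subseteq> tableaux G n \<sigma>"
  using assms by (auto simp: tabloids_def quotient_def row_equivalence_def)

lemma tabloid_action:
  "group_action (wreath G n) (tabloids G n \<sigma>)
    (\<lambda>w. restrict (act_tabloid G \<sigma> w) (tabloids G n \<sigma>))"
proof (rule group_actionI[OF group_wreath])
  fix a
  assume a: "a \<in> tabloids G n \<sigma>"
  note sub = subsetD[OF tabloid_subset[OF a]]
  show "act_tabloid G \<sigma> \<one>\<^bsub>wreath G n\<^esub> a = a"
    using sub act_tableau_one by (force simp: act_tabloid_def)
  fix w
  assume w: "w \<in> carrier (wreath G n)"
  with a show "act_tabloid G \<sigma> w a \<in> tabloids G n \<sigma>"
    by (simp add: act_tabloid_closed)
  fix v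
  assume "v \<in> carrier (wreath G n)"
  with w show "act_tabloid G \<sigma> (v \<otimes>\<^bsub>wreath G n\<^esub> w) a = act_tabloid G \<sigma> v (act_tabloid G \<sigma> w a)"
    using act_tableau_mult sub by (simp add: act_tabloid_def image_image cong: image_cong)
qed

lemma tabloid_action_transitive:
  assumes "finite (carrier G)" "\<sigma> \<in> Sigma_maps G n" "a \<in> tabloids G n \<sigma>" "b \<in> tabloids G n \<sigma>"
  obtains w where "w \<in> carrier (wreath G n)" "act_tabloid G \<sigma> w a = b"
proof -
  obtain S T where S: "S \<in> tableaux G n \<sigma>" "a = row_equivalence G n \<sigma> `` {S}"
    and T: "T \<in> tableaux G n \<sigma>" "b = row_equivalence G n \<sigma> `` {T}"
    using assms(3,4) by (auto simp: tabloids_def elim!: quotientE)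
  obtain w where "w \<in> carrier (wreath G n)" "act_tableau G \<sigma> w S = T"
    using act_tableau_transitive[OF assms(1,2) S(1) T(1)] .
  with S T show thesis
    by (intro that[of w]) (simp_all add: act_tabloid_class)
qed

end

section \<open>Counting tabloids and the fibres of the evaluation maps\<close>

theorem theorem4p11:
  fixes G :: "('a, 'b) monoid_scheme" and n :: nat
    and \<sigma> :: "'a set \<Rightarrow> nat list" and t :: "'a tableau set"
    and H Y :: "((nat \<Rightarrow> 'a) \<times> (nat \<Rightarrow> nat)) set"
  assumes "comm_group G" and "finite (carrier G)" and "n > 0"
    and "\<sigma> \<in> Sigma_maps G n"
    and "t \<in> tabloids G n \<sigma>"
    and "H = stabilizer (wreath G n) (act_tabloid G \<sigma>) t"
    and "Y \<subseteq> carrier (wreath G n)" and "Y \<noteq> {}"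
  shows
    "(clique G n \<sigma> Y \<longrightarrow>
        real (card Y) \<le> real (order (wreath G n)) / real (card H) \<and>
        (real (card Y) = real (order (wreath G n)) / real (card H) \<longleftrightarrow> transitive G n \<sigma> Y)) \<and>
     (transitive G n \<sigma> Y \<longrightarrow>
        real (card Y) \<ge> real (order (wreath G n)) / real (card H) \<and>
        (real (card Y) = real (order (wreath G n)) / real (card H) \<longleftrightarrow> clique G n \<sigma> Y)) \<and>
     ((clique G n \<sigma> Y \<or> transitive G n \<sigma> Y) \<and>
        real (card Y) = real (order (wreath G n)) / real (card H) \<longrightarrow>
        sharply_transitive G n \<sigma> Y)"
proof -
  interpret comm_group G by fact
  let ?W = "wreath G n" and ?E = "tabloids G n \<sigma>" and ?act = "act_tabloid G \<sigma>"
  interpret W: group ?W by (rule group_wreath)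
  interpret group_action ?W ?E "\<lambda>w. restrict (?act w) ?E" by (rule tabloid_action)
  have finW: "finite (carrier ?W)"
    by (rule finite_wreath) fact
  then have finY: "finite Y"
    using assms(7) finite_subset by blast
  have orbit: "orbit ?W (\<lambda>w. restrict (?act w) ?E) t = ?E"
    using assms(5) tabloid_action_transitive[OF assms(2,4,5)] act_tabloid_closed
    unfolding orbit_def by (auto, metis)
  \<comment> \<open>Finiteness of the set of tabloids is inherited from the group, of which the
    single orbit is an image.\<close>
  have "finite (orbit ?W (\<lambda>w. restrict (?act w) ?E) t)"
    unfolding orbit_def Setcompr_eq_image using finW by (rule finite_imageI)
  then have finE: "finite ?E"
    unfolding orbit .
  have cardE0: "card ?E > 0"
    using finE assms(5) by (auto simp: card_gt_0_iff)
  \<comment> \<open>The stabiliser looks only at the value at \<open>t\<close>, which is a tabloid,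
    so restricting the action does not change it.\<close>
  have H: "H = stabilizer ?W (\<lambda>w. restrict (?act w) ?E) t"
    using assms(5,6) by (simp add: stabilizer_def)
  have "card ?E * card H = order ?W"
    using orbit_stabilizer_theorem[OF assms(5)] unfolding H orbit .
  moreover have "card H > 0"
    using calculation finW W.order_gt_0_iff_finite by (metis mult_0_right neq0_conv)
  \<comment> \<open>From here on the bound in the theorem is the number of tabloids.\<close>
  ultimately have index: "real (order ?W) / real (card H) = real (card ?E)"
    by (metis less_numeral_extra(3) nonzero_mult_div_cancel_right of_nat_eq_0_iff of_nat_mult)

  have act_E: "?act y a \<in> ?E" if "y \<in> Y" "a \<in> ?E" for y a
    using that assms(7) act_tabloid_closed by blast
  \<comment> \<open>Applying \<open>x\<close> to both sides turns a fixed tabloid of the quotient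
    into a collision of the evaluation map at \<open>a\<close>, and applying its inverse goes
    back.\<close>
  have fix_iff: "?act (inv\<^bsub>?W\<^esub> x \<otimes>\<^bsub>?W\<^esub> y) a = a \<longleftrightarrow> ?act x a = ?act y a"
    if "x \<in> Y" "y \<in> Y" "a \<in> ?E" for x y a
  proof -
    have xy: "x \<in> carrier ?W" "y \<in> carrier ?W"
      using that assms(7) by auto
    have "?act (inv\<^bsub>?W\<^esub> x \<otimes>\<^bsub>?W\<^esub> y) a = ?act (inv\<^bsub>?W\<^esub> x) (?act y a)"
      using composition_rule[of a "inv\<^bsub>?W\<^esub> x" y] that xy act_E by simp
    moreover have "?act x (?act (inv\<^bsub>?W\<^esub> x) b) = b" "?act (inv\<^bsub>?W\<^esub> x) (?act x b) = b"
      if "b \<in> ?E" for b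
      using composition_rule[of b x "inv\<^bsub>?W\<^esub> x"] composition_rule[of b "inv\<^bsub>?W\<^esub> x" x]
        fun_cong[OF id_eq_one, of b] that xy act_tabloid_closed by simp_all
    ultimately show ?thesis
      using that act_E by metis
  qed
  have clique_iff: "clique G n \<sigma> Y \<longleftrightarrow> (\<forall>a\<in>?E. inj_on (\<lambda>y. ?act y a) Y)"
  proof -
    have "clique G n \<sigma> Y \<longleftrightarrow>
        (\<forall>x\<in>Y. \<forall>y\<in>Y. x \<noteq> y \<longrightarrow> \<not> (\<exists>a\<in>?E. ?act x a = ?act y a))"
      by (simp add: clique_def fix_iff cong: ball_cong bex_cong)
    then show ?thesis
      unfolding inj_on_def by blast
  qed
  also have "\<dots> \<longleftrightarrow> (\<forall>a\<in>?E. \<forall>b\<in>?E. card {y \<in> Y. ?act y a = b} \<le> 1)"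
    using inj_on_iff_card_fibres_le_1[OF finY, of "\<lambda>y. ?act y _" ?E] act_E by (intro ball_cong) auto
  finally have clique_fibres: "clique G n \<sigma> Y \<longleftrightarrow> \<dots>" .
  have card_trans: "card Y = c * card ?E" if "transitive_with G n \<sigma> c Y" for c
    using that card_eq_mult_of_const_fibres[OF finY finE act_E[OF _ assms(5)]] assms(5)
    by (simp add: transitive_with_def)
  \<comment> \<open>Evaluation at the single tabloid \<open>t\<close> already embeds a clique into
    the tabloids.\<close>
  have clique_le: "card Y \<le> card ?E" if "clique G n \<sigma> Y"
    using that clique_iff assms(5) act_E finE
    by (intro card_inj_on_le[of "\<lambda>y. ?act y t"]) auto
  \<comment> \<open>An injection between finite sets of equal size is a bijection, so every fibre is
    a singleton.\<close>
  have clique_sharp: "sharply_transitive G n \<sigma> Y" if "clique G n \<sigma> Y" "card Y = card ?E"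
  proof -
    have "bij_betw (\<lambda>y. ?act y a) Y ?E" if "a \<in> ?E" for a
    proof -
      have inj: "inj_on (\<lambda>y. ?act y a) Y"
        using \<open>clique G n \<sigma> Y\<close> that clique_iff by blast
      have "(\<lambda>y. ?act y a) ` Y = ?E"
        by (rule card_subset_eq[OF finE])
          (use act_E[OF _ that] \<open>card Y = card ?E\<close> card_image[OF inj] in auto)
      with inj show ?thesis
        by (simp add: bij_betw_def)
    qed
    then show ?thesis
      unfolding sharply_transitive_def transitive_with_def
      by (intro ballI) (rule bij_betw_imp_card_fibre)
  qed
  \<comment> \<open>With \<open>card Y = c * card ?E\<close> and a positive number of tabloids,
    equality forces \<open>c = 1\<close>.\<close>
  have trans_sharp: "sharply_transitive G n \<sigma> Y"
    if "transitive G n \<sigma> Y" "card Y = card ?E"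
    using that card_trans cardE0 by (auto simp: transitive_def sharply_transitive_def)
  \<comment> \<open>Fibres of size exactly 1 satisfy both the clique bound and the transitivity
    condition, and \<open>c = 1\<close> gives the size.\<close>
  have sharp: "clique G n \<sigma> Y" "transitive G n \<sigma> Y" "card Y = card ?E"
    if "sharply_transitive G n \<sigma> Y"
    using that card_trans[of 1]
    by (auto simp: clique_fibres transitive_def sharply_transitive_def transitive_with_def)
  have trans_ge: "card ?E \<le> card Y" if "transitive G n \<sigma> Y"
    using that card_trans by (auto simp: transitive_def)
  \<comment> \<open>Equality makes a clique or a transitive set sharply transitive, hence both.
    Conversely, a set that is both satisfies the two opposite inequalities, so equality
    holds.\<close>
  show ?thesis
    unfolding index of_nat_le_iff of_nat_eq_iff
    using clique_le clique_sharp trans_sharp sharp trans_ge by (blast intro: le_antisym)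
qed

end
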